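(* There exists a spherically symmetric perturbation $D_1\in L^\infty$, $D_1\not\equiv0$ (that is, $D_1$ is radial and supported in a ball $B$ centered at the origin), such that $M_{ij}=0$ for all $i,j\in\mathbb N^d$ with $|i|=|j|=1$, where $M=M[D_1]$ is the polarization tensor associated with $D_1$.
   Context: Let $d\ge2$. $D_0(x_0)>0$ is the (given) value of the background diffusion coefficient at the inclusion's location $x_0$. An admissible perturbation is a bounded measurable function $D_1$ on $\mathbb R^d$ vanishing outside $\overline B$, with $D_0(x_0)+D_1\ge C_0>0$ a.e. for some constant $C_0$. Multi-index notation: $x^i=x_1^{i_1}\cdots x_d^{i_d}$, $|i|=i_1+\dots+i_d$. The polarization tensor is $$M_{ij}=M_{ij}[D_1]=\int_BD_1(x)\,\nabla\big(x^j+\phi_{j0}^0(x)\big)\cdot\nabla x^i\,dx,\qquad i,j\in\mathbb N^d,$$ where $\phi_{j0}^0$ is the unique function in $H^1_{\rm loc}(\mathbb R^d)\cap C^\infty(\mathbb R^d\setminus\overline B)$ with $\nabla\cdot\big(D_0(x_0)+D_1(x)\big)\nabla\phi_{j0}^0=-\nabla\cdot\big(D_1(x)\nabla x^j\big)$ in the sense of distributions in $\mathbb R^d$ and $\phi_{j0}^0(x)=\mathcal O(|x|^{1-d})$ as $|x|\to\infty$. *)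

theory Defs
  imports "HOL-Analysis.Analysis" "HOL-Library.Landau_Symbols"
begin

definition grad :: "(real^'n::finite \<Rightarrow> real) \<Rightarrow> real^'n \<Rightarrow> real^'n" where
  "grad f x = (\<chi> k. frechet_derivative f (at x) (axis k 1))"

text \<open>Smoothness is only used on open sets \<open>S\<close>, where differentiability within \<open>S\<close> coincides
  with differentiability at the points of \<open>S\<close>.\<close>

primrec Ck_on :: "nat \<Rightarrow> (real^'n::finite) set \<Rightarrow> (real^'n \<Rightarrow> real) \<Rightarrow> bool" where
  "Ck_on 0 S f \<longleftrightarrow> continuous_on S f"
| "Ck_on (Suc m) S f \<longleftrightarrow> f differentiable_on S \<and> (\<forall>k. Ck_on m S (\<lambda>x. grad f x $ k))"

definition smooth_on :: "(real^'n::finite) set \<Rightarrow> (real^'n \<Rightarrow> real) \<Rightarrow> bool" where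
  "smooth_on S f \<longleftrightarrow> (\<forall>m. Ck_on m S f)"

definition test_function :: "(real^'n::finite \<Rightarrow> real) \<Rightarrow> bool" where
  "test_function \<psi> \<longleftrightarrow> smooth_on UNIV \<psi> \<and> compact (closure {x. \<psi> x \<noteq> 0})"

definition locally_integrable ::
    "('a::euclidean_space \<Rightarrow> 'b::euclidean_space) \<Rightarrow> bool" where
  "locally_integrable u \<longleftrightarrow> (\<forall>K. compact K \<longrightarrow> u absolutely_integrable_on K)"

definition has_weak_gradient ::
    "(real^'n::finite \<Rightarrow> real) \<Rightarrow> (real^'n \<Rightarrow> real^'n) \<Rightarrow> bool" where
  "has_weak_gradient u g \<longleftrightarrow> locally_integrable u \<and> locally_integrable g \<and>
     (\<forall>\<psi>. test_function \<psi> \<longrightarrow>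
        (LINT x|lebesgue. u x *\<^sub>R grad \<psi> x) = - (LINT x|lebesgue. \<psi> x *\<^sub>R g x))"

text \<open>Weak gradients are unique up to null sets, and they are used only under integrals below,
  so the choice of representative is immaterial.\<close>

definition weak_gradient :: "(real^'n::finite \<Rightarrow> real) \<Rightarrow> real^'n \<Rightarrow> real^'n" where
  "weak_gradient u = (SOME g. has_weak_gradient u g)"

definition H1_loc :: "(real^'n::finite \<Rightarrow> real) \<Rightarrow> bool" where
  "H1_loc u \<longleftrightarrow> u \<in> borel_measurable lebesgue \<and> locally_integrable (\<lambda>x. (u x)\<^sup>2) \<and>
     (\<exists>g. has_weak_gradient u g \<and> locally_integrable (\<lambda>x. (norm (g x))\<^sup>2))"

text \<open>The distribution \<open>\<nabla> \<cdot> V\<close> of a locally integrable vector field \<open>V\<close>, applied to \<open>\<psi>\<close>.\<close>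

definition distr_div ::
    "(real^'n::finite \<Rightarrow> real^'n) \<Rightarrow> (real^'n \<Rightarrow> real) \<Rightarrow> real" where
  "distr_div V \<psi> = - (LINT x|lebesgue. V x \<bullet> grad \<psi> x)"

definition monomial :: "('n::finite \<Rightarrow> nat) \<Rightarrow> real^'n \<Rightarrow> real" where
  "monomial i x = (\<Prod>k\<in>UNIV. (x $ k) ^ i k)"

definition mi_order :: "('n::finite \<Rightarrow> nat) \<Rightarrow> nat" where
  "mi_order i = (\<Sum>k\<in>UNIV. i k)"

text \<open>Throughout, \<open>d0\<close> is the background diffusion coefficient \<open>D\<^sub>0(x\<^sub>0)\<close> at the location of
  the inclusion.\<close>

definition admissible ::
    "real \<Rightarrow> (real^'n::finite) set \<Rightarrow> (real^'n \<Rightarrow> real) \<Rightarrow> bool" where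
  "admissible d0 B D1 \<longleftrightarrow>
     D1 \<in> borel_measurable lebesgue \<and> bounded (range D1) \<and>
     (\<forall>x. x \<notin> closure B \<longrightarrow> D1 x = 0) \<and>
     (\<exists>C0>0. AE x in lebesgue. d0 + D1 x \<ge> C0)"

definition is_corrector ::
    "real \<Rightarrow> (real^'n::finite) set \<Rightarrow> (real^'n \<Rightarrow> real) \<Rightarrow> ('n \<Rightarrow> nat) \<Rightarrow> (real^'n \<Rightarrow> real) \<Rightarrow> bool"
  where
  "is_corrector d0 B D1 j \<phi> \<longleftrightarrow>
     H1_loc \<phi> \<and> smooth_on (- closure B) \<phi> \<and>
     (\<forall>\<psi>. test_function \<psi> \<longrightarrow>
        distr_div (\<lambda>x. (d0 + D1 x) *\<^sub>R weak_gradient \<phi> x) \<psi>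
        = - distr_div (\<lambda>x. D1 x *\<^sub>R grad (monomial j) x) \<psi>) \<and>
     \<phi> \<in> O[at_infinity](\<lambda>x. norm x powr (1 - real CARD('n)))"

text \<open>The corrector is unique as an element of \<open>H\<^sup>1\<^sub>l\<^sub>o\<^sub>c\<close>, i.e. up to a null set; \<open>corrector\<close>
  picks a representative.\<close>

definition corrector ::
    "real \<Rightarrow> (real^'n::finite) set \<Rightarrow> (real^'n \<Rightarrow> real) \<Rightarrow> ('n \<Rightarrow> nat) \<Rightarrow> real^'n \<Rightarrow> real" where
  "corrector d0 B D1 j = (SOME \<phi>. is_corrector d0 B D1 j \<phi>)"

definition polarization_tensor ::
    "real \<Rightarrow> (real^'n::finite) set \<Rightarrow> (real^'n \<Rightarrow> real) \<Rightarrow> ('n \<Rightarrow> nat) \<Rightarrow> ('n \<Rightarrow> nat) \<Rightarrow> real" where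
  "polarization_tensor d0 B D1 i j =
     (LINT x:B|lebesgue.
        D1 x * (weak_gradient (\<lambda>y. monomial j y + corrector d0 B D1 j y) x
                  \<bullet> grad (monomial i) x))"

definition spherically_symmetric :: "('a::real_normed_vector \<Rightarrow> real) \<Rightarrow> bool" where
  "spherically_symmetric f \<longleftrightarrow> (\<forall>x y. norm x = norm y \<longrightarrow> f x = f y)"

end

theory Submission
  imports Defs
begin

text \<open>
  The idea is a smooth version of the classical \<^emph>\<open>neutral inclusion\<close>. Look for a radial
  coefficient \<open>D = d0 + D1\<close> and a radial factor \<open>f\<close>, equal to \<open>1\<close> outside the ball, such that each
  deformed coordinate \<open>f(|x|\<^sup>2) x\<^sub>l\<close> satisfies \<open>\<nabla> \<cdot> (D \<nabla> (f x\<^sub>l)) = 0\<close>. Such an inclusion leaves the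
  uniform field \<open>e\<^sub>l\<close> outside the ball undisturbed. Put \<open>\<phi>\<^sub>l = (f - 1) x\<^sub>l\<close>. This is a test function, and
  the equation reads \<open>\<nabla> \<cdot> (D \<nabla> \<phi>\<^sub>l) = - \<partial>\<^sub>l D1\<close>.

  \<^item> \<^emph>\<open>A corrector exists\<close>: \<open>\<phi>\<^sub>m\<close> is one for the monomial \<open>x\<^sub>m\<close>, and its decay is trivial because it
    vanishes outside the ball (\<open>is_corrector_neutral\<close>).
  \<^item> \<^emph>\<open>Every corrector gives a vanishing entry\<close>: let \<open>\<Phi>\<close> be any corrector for \<open>x\<^sub>m\<close> and \<open>u = x\<^sub>m + \<Phi>\<close>.
    As \<open>D1\<close> is itself a test function, the entry of the tensor is
    \<open>\<integral> D1 \<partial>\<^sub>l u = - \<integral> u \<partial>\<^sub>l D1 = \<integral> u \<nabla> \<cdot> (D \<nabla> \<phi>\<^sub>l)\<close>, and this is zero because \<open>\<nabla> \<cdot> (D \<nabla> u) = 0\<close> may be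
    tested with \<open>\<phi>\<^sub>l\<close> (\<open>polarization_tensor_neutral\<close>).
    Only integrals of \<open>u\<close> against test functions occur, so the argument applies to whichever corrector
    and whichever weak gradient the definitions choose.
  \<^item> \<^emph>\<open>The coefficient exists\<close>: with \<open>D = h(s)\<close>, \<open>s = |x|\<^sup>2\<close> and \<open>n\<close> the dimension, the equation for
    \<open>f x\<^sub>l\<close> becomes one ordinary differential equation,
    \<open>h' (f + 2 s f') + h ((n + 2) f' + 2 s f'') = 0\<close> (\<open>div_radial_flux\<close>). For a prescribed \<open>f\<close> it is linear
    of first order in \<open>h\<close>. Starting from a smooth bump \<open>f' / f\<close> supported in \<open>[0, R\<^sup>2]\<close> and integrating
    inwards from \<open>s = R\<^sup>2\<close> gives smooth positive solutions that are constant for \<open>s \<ge> R\<^sup>2\<close>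
    (\<open>neutral_profile_exists\<close>).

  The integration by parts needed for smooth functions rests on \<open>\<integral> \<partial>\<^sub>k \<psi> = 0\<close> for test functions, which is
  the infinitesimal form of the translation invariance of Lebesgue measure.
\<close>

section \<open>Partial derivatives and smooth functions on Euclidean space\<close>

lemma grad_eqI:
  assumes "(f has_derivative f') (at x)"
  shows "grad f x $ k = f' (axis k 1)"
  using frechet_derivative_at[OF assms] by (simp add: grad_def)

lemma grad_const [simp]: "grad (\<lambda>x. c) x $ k = 0"
  by (rule grad_eqI[where f' = "\<lambda>_. 0"]) (auto intro!: derivative_eq_intros)

lemma grad_nth: "grad (\<lambda>x. x $ i) x $ k = (if k = i then 1 else 0)"
  by (subst grad_eqI[where f' = "\<lambda>v. v $ i"])
     (auto simp: axis_def bounded_linear_imp_has_derivative bounded_linear_vec_nth)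

lemma grad_add:
  assumes "f differentiable (at x)" "g differentiable (at x)"
  shows "grad (\<lambda>x. f x + g x) x $ k = grad f x $ k + grad g x $ k"
  by (subst grad_eqI[OF has_derivative_add[OF assms[unfolded frechet_derivative_works]]])
     (simp add: grad_def)

lemma grad_mult:
  assumes "f differentiable (at x)" "g differentiable (at x)"
  shows "grad (\<lambda>x. f x * g x) x $ k = f x * grad g x $ k + g x * grad f x $ k"
  by (subst grad_eqI[OF has_derivative_mult[OF assms[unfolded frechet_derivative_works]]])
     (simp add: grad_def)

lemma grad_compose:
  assumes "(h has_real_derivative h') (at (g x))" "g differentiable (at x)"
  shows "grad (\<lambda>x. h (g x)) x $ k = h' * grad g x $ k"
proof -
  have "((\<lambda>x. h (g x)) has_derivative (\<lambda>v. h' * frechet_derivative g (at x) v)) (at x)"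
    using has_derivative_compose[OF assms(2)[unfolded frechet_derivative_works]
        assms(1)[unfolded has_field_derivative_def]] by simp
  from grad_eqI[OF this] show ?thesis by (simp add: grad_def)
qed

lemma Ck_on_Suc_D: "Ck_on (Suc m) S f \<Longrightarrow> Ck_on m S f"
  by (induction m arbitrary: f) (auto simp: differentiable_imp_continuous_on)

lemma Ck_on_subset: "Ck_on m T f \<Longrightarrow> S \<subseteq> T \<Longrightarrow> Ck_on m S f"
  by (induction m arbitrary: f) (auto intro: continuous_on_subset differentiable_on_subset)

lemma Ck_on_UNIV_differentiable: "Ck_on (Suc m) UNIV f \<Longrightarrow> f differentiable (at x)"
  by (simp add: differentiable_on_def)

lemma Ck_on_UNIV_SucI:
  assumes "\<And>x. f differentiable (at x)" "\<And>k. Ck_on m UNIV (\<lambda>x. grad f x $ k)"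
  shows "Ck_on (Suc m) UNIV f"
  using assms by (simp add: differentiable_on_def)

lemma Ck_on_UNIV_const: "Ck_on m UNIV (\<lambda>x. c)"
  by (induction m arbitrary: c) auto

lemma Ck_on_UNIV_nth: "Ck_on m UNIV (\<lambda>x. x $ i)"
proof (cases m)
  case (Suc l)
  show ?thesis unfolding Suc
    by (rule Ck_on_UNIV_SucI) (auto simp: grad_nth Ck_on_UNIV_const
       intro: bounded_linear_imp_differentiable bounded_linear_vec_nth)
qed (simp add: continuous_on_component)

lemma Ck_on_UNIV_add:
  "Ck_on m UNIV f \<Longrightarrow> Ck_on m UNIV g \<Longrightarrow> Ck_on m UNIV (\<lambda>x. f x + g x)"
proof (induction m arbitrary: f g)
  case (Suc m)
  note d = Suc.prems[THEN Ck_on_UNIV_differentiable]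
  show ?case
    by (rule Ck_on_UNIV_SucI) (use d Suc in \<open>auto simp: grad_add\<close>)
qed (auto intro: continuous_on_add)

lemma Ck_on_UNIV_mult:
  "Ck_on m UNIV f \<Longrightarrow> Ck_on m UNIV g \<Longrightarrow> Ck_on m UNIV (\<lambda>x. f x * g x)"
proof (induction m arbitrary: f g)
  case (Suc m)
  note d = Suc.prems[THEN Ck_on_UNIV_differentiable]
  note l = Suc.prems[THEN Ck_on_Suc_D]
  show ?case
    by (rule Ck_on_UNIV_SucI)
       (use d l Suc in \<open>auto simp: grad_mult intro!: Ck_on_UNIV_add\<close>)
qed (auto intro: continuous_on_mult)

section \<open>Smooth functions of one real variable\<close>

text \<open>The derivative is a witness rather than \<open>deriv\<close>, so that closure properties follow by exhibiting
  the derivative that the calculus rules produce.\<close>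

primrec Ck_real :: "nat \<Rightarrow> (real \<Rightarrow> real) \<Rightarrow> bool" where
  "Ck_real 0 h \<longleftrightarrow> continuous_on UNIV h"
| "Ck_real (Suc m) h \<longleftrightarrow> (\<exists>h'. (\<forall>s. (h has_real_derivative h' s) (at s)) \<and> Ck_real m h')"

lemma Ck_real_SucI:
  assumes "\<And>s. (h has_real_derivative h' s) (at s)" "Ck_real m h'"
  shows "Ck_real (Suc m) h"
  using assms by auto

lemma Ck_real_Suc_D: "Ck_real (Suc m) h \<Longrightarrow> Ck_real m h"
proof (induction m arbitrary: h)
  case 0
  then obtain h' where "\<And>s. (h has_real_derivative h' s) (at s)" by auto
  then show ?case using DERIV_continuous_on[of UNIV h h'] by simp
next
  case (Suc m)
  then show ?case by (metis Ck_real.simps(2))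
qed

lemma Ck_on_UNIV_compose:
  "Ck_real m h \<Longrightarrow> Ck_on m UNIV g \<Longrightarrow> Ck_on m UNIV (\<lambda>x. h (g x))"
proof (induction m arbitrary: h g)
  case 0
  then show ?case by (auto intro: continuous_on_compose2)
next
  case (Suc m)
  then obtain h' where h': "\<And>s. (h has_real_derivative h' s) (at s)" "Ck_real m h'"
    by auto
  have d: "g differentiable (at x)" for x
    using Suc.prems(2) by (rule Ck_on_UNIV_differentiable)
  show ?case
  proof (rule Ck_on_UNIV_SucI)
    show "(\<lambda>x. h (g x)) differentiable (at x)" for x
      using d h'(1) by (metis differentiable_compose field_differentiable_def
          field_differentiable_imp_differentiable)
    show "Ck_on m UNIV (\<lambda>x. grad (\<lambda>x. h (g x)) x $ k)" for k
      using Suc.prems(2) Suc.IH[OF h'(2) Ck_on_Suc_D[OF Suc.prems(2)]]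
      by (simp add: grad_compose[OF h'(1) d] Ck_on_UNIV_mult)
  qed
qed

lemma Ck_real_const: "Ck_real m (\<lambda>s. c)"
  by (induction m arbitrary: c) (auto intro!: exI[where x = "\<lambda>_. 0"] derivative_eq_intros)

lemma Ck_real_ident: "Ck_real m (\<lambda>s. s)"
  by (cases m) (auto intro!: exI[where x = "\<lambda>_. 1"] derivative_eq_intros Ck_real_const)

lemma Ck_real_add:
  "Ck_real m f \<Longrightarrow> Ck_real m g \<Longrightarrow> Ck_real m (\<lambda>s. f s + g s)"
proof (induction m arbitrary: f g)
  case (Suc m)
  then obtain f' g' where
    "\<And>s. (f has_real_derivative f' s) (at s)" "Ck_real m f'"
    "\<And>s. (g has_real_derivative g' s) (at s)" "Ck_real m g'" by auto
  with Suc.IH show ?case by (auto intro!: exI[where x = "\<lambda>s. f' s + g' s"] DERIV_add)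
qed (auto intro: continuous_on_add)

lemma Ck_real_mult:
  "Ck_real m f \<Longrightarrow> Ck_real m g \<Longrightarrow> Ck_real m (\<lambda>s. f s * g s)"
proof (induction m arbitrary: f g)
  case (Suc m)
  then obtain f' g' where
    d: "\<And>s. (f has_real_derivative f' s) (at s)" "Ck_real m f'"
    "\<And>s. (g has_real_derivative g' s) (at s)" "Ck_real m g'" by auto
  show ?case
    by (rule Ck_real_SucI[where h' = "\<lambda>s. f' s * g s + g' s * f s"])
       (intro DERIV_mult Ck_real_add Suc.IH d Suc.prems[THEN Ck_real_Suc_D])+
qed (auto intro: continuous_on_mult)

lemma Ck_real_diff:
  assumes "Ck_real m f" "Ck_real m g"
  shows "Ck_real m (\<lambda>s. f s - g s)"
  using Ck_real_add[OF assms(1) Ck_real_mult[OF Ck_real_const[of m "-1"] assms(2)]] by simp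

lemma Ck_real_compose:
  "Ck_real m h \<Longrightarrow> Ck_real m g \<Longrightarrow> Ck_real m (\<lambda>s. h (g s))"
proof (induction m arbitrary: h g)
  case (Suc m)
  then obtain h' g' where
    d: "\<And>s. (h has_real_derivative h' s) (at s)" "Ck_real m h'"
    "\<And>s. (g has_real_derivative g' s) (at s)" "Ck_real m g'" by auto
  show ?case
    by (rule Ck_real_SucI[where h' = "\<lambda>s. h' (g s) * g' s"])
       (rule DERIV_chain2[OF d(1,3)],
        rule Ck_real_mult[OF Suc.IH[OF d(2) Suc.prems(2)[THEN Ck_real_Suc_D]] d(4)])
qed (auto intro: continuous_on_compose2)

lemma Ck_real_exp: "Ck_real m exp"
  by (induction m) (auto intro!: exI[where x = exp] DERIV_exp continuous_intros)

lemma Ck_real_inverse: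
  assumes "\<And>s. g s \<noteq> 0"
  shows "Ck_real m g \<Longrightarrow> Ck_real m (\<lambda>s. inverse (g s))"
proof (induction m)
  case (Suc m)
  then obtain g' where
    g': "\<And>s. (g has_real_derivative g' s) (at s)" "Ck_real m g'" by auto
  have "Ck_real m (\<lambda>s. inverse (g s))"
    using Suc Ck_real_Suc_D by blast
  hence "Ck_real m (\<lambda>s. (- 1) * (inverse (g s) * g' s * inverse (g s)))"
    by (intro Ck_real_mult Ck_real_const g')
  moreover have "((\<lambda>s. inverse (g s)) has_real_derivative
      (- 1) * (inverse (g s) * g' s * inverse (g s))) (at s)" for s
    using DERIV_inverse'[OF g'(1) assms] by simp
  ultimately show ?case by (intro Ck_real_SucI)
qed (auto intro: continuous_on_inverse simp: assms)

text \<open>The classical function with a flat zero: \<open>exp (- 1 / s)\<close> for \<open>s > 0\<close>, continued by \<open>0\<close>. The extra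
  factor \<open>1 / s ^ n\<close> makes the span of the family closed under differentiation, so smoothness of all members
  is one induction.\<close>

definition flat :: "nat \<Rightarrow> real \<Rightarrow> real" where
  "flat n s = (if s \<le> 0 then 0 else (1 / s) ^ n / exp (1 / s))"

lemma flat_nonneg: "flat n s \<ge> 0" by (simp add: flat_def)

lemma flat_pos: "s > 0 \<Longrightarrow> flat n s > 0" by (simp add: flat_def)

lemma flat_0_le_1: "flat 0 s \<le> 1" by (simp add: flat_def)

text \<open>The exponential beats every power of \<open>1 / s\<close>; this makes the difference quotient at \<open>0\<close> vanish,
  since \<open>flat n s / s = flat (Suc n) s\<close>.\<close>

lemma flat_tendsto_0: "(flat n \<longlongrightarrow> 0) (at 0)"
proof (rule filterlim_split_at)
  have "((\<lambda>s. (1 / s) ^ n / exp (1 / s)) \<longlongrightarrow> 0) (at_right (0::real))"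
    using filterlim_compose[OF tendsto_power_div_exp_0 filterlim_inverse_at_top_right]
    by (simp add: field_simps)
  then show "(flat n \<longlongrightarrow> 0) (at_right 0)"
    by (rule Lim_transform_eventually)
       (auto simp: flat_def eventually_at_filter)
  show "(flat n \<longlongrightarrow> 0) (at_left 0)"
    by (rule Lim_transform_eventually[OF tendsto_const])
       (auto simp: flat_def eventually_at_filter)
qed

lemma flat_has_derivative:
  "(flat n has_real_derivative flat (n + 2) s - real n * flat (n + 1) s) (at s)"
proof (cases s "0::real" rule: linorder_cases)
  case less
  have "((\<lambda>_. 0) has_real_derivative 0) (at s)" by simp
  then have "(flat n has_real_derivative 0) (at s)"
    by (rule has_field_derivative_transform_within_open[where S = "{..<0}"])
       (use less in \<open>auto simp: flat_def\<close>)
  with less show ?thesis by (simp add: flat_def)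
next
  case equal
  have "((\<lambda>h. (flat n (0 + h) - flat n 0) / h) \<longlongrightarrow> 0) (at 0)"
    by (rule Lim_transform_eventually[OF flat_tendsto_0[of "Suc n"]])
       (auto simp: flat_def eventually_at_filter)
  then have "(flat n has_real_derivative 0) (at 0)"
    by (simp add: has_field_derivative_iff)
  with equal show ?thesis by (simp add: flat_def)
next
  case greater
  have "((\<lambda>s. (1 / s) ^ n / exp (1 / s)) has_real_derivative
      flat (n + 2) s - real n * flat (n + 1) s) (at s)"
    using greater
    apply (auto intro!: derivative_eq_intros simp: flat_def)
    apply (cases n)
    apply (auto simp: field_simps power2_eq_square)
    done
  then show ?thesis
    by (rule has_field_derivative_transform_within_open[where S = "{0<..}"])
       (use greater in \<open>auto simp: flat_def\<close>)
qed

lemma Ck_real_flat: "Ck_real m (flat n)"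
proof (induction m arbitrary: n)
  case 0
  show ?case by (auto intro!: DERIV_continuous_on flat_has_derivative)
next
  case (Suc m)
  have "Ck_real m (\<lambda>s. flat (n + 2) s - real n * flat (n + 1) s)"
    by (intro Ck_real_diff Ck_real_mult Ck_real_const Suc)
  with flat_has_derivative show ?case by (rule Ck_real_SucI)
qed

lemma continuous_antiderivative:
  fixes q :: "real \<Rightarrow> real"
  assumes "continuous_on UNIV q"
  obtains p where "\<And>s. (p has_real_derivative q s) (at s)" "p s0 = 0"
proof -
  have "\<exists>F. \<forall>x. - \<infinity> < ereal x \<longrightarrow> ereal x < \<infinity> \<longrightarrow> (F has_vector_derivative q x) (at x)"
    by (rule einterval_antiderivative)
       (use assms in \<open>auto simp: continuous_on_eq_continuous_at\<close>)
  then obtain F where F: "\<And>x. (F has_real_derivative q x) (at x)"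
    by (auto simp: has_real_derivative_iff_has_vector_derivative)
  show ?thesis
    by (rule that[of "\<lambda>s. F s - F s0"]) (auto intro!: derivative_eq_intros F)
qed


section \<open>Test functions\<close>

lemma smooth_on_UNIV_differentiable: "smooth_on UNIV f \<Longrightarrow> f differentiable (at x)"
  unfolding smooth_on_def using Ck_on_UNIV_differentiable by blast

lemma smooth_on_UNIV_grad: "smooth_on UNIV f \<Longrightarrow> smooth_on UNIV (\<lambda>x. grad f x $ k)"
  unfolding smooth_on_def by (metis Ck_on.simps(2))

lemma smooth_on_UNIV_continuous: "smooth_on UNIV f \<Longrightarrow> continuous_on UNIV f"
  unfolding smooth_on_def by (metis Ck_on.simps(1))

lemma smooth_on_UNIV_mult:
  "smooth_on UNIV f \<Longrightarrow> smooth_on UNIV g \<Longrightarrow> smooth_on UNIV (\<lambda>x. f x * g x)"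
  by (simp add: smooth_on_def Ck_on_UNIV_mult)

lemma smooth_on_UNIV_add:
  "smooth_on UNIV f \<Longrightarrow> smooth_on UNIV g \<Longrightarrow> smooth_on UNIV (\<lambda>x. f x + g x)"
  by (simp add: smooth_on_def Ck_on_UNIV_add)

lemma smooth_on_UNIV_const: "smooth_on UNIV (\<lambda>x. c)"
  by (simp add: smooth_on_def Ck_on_UNIV_const)

lemma smooth_on_UNIV_nth: "smooth_on UNIV (\<lambda>x. x $ i)"
  by (simp add: smooth_on_def Ck_on_UNIV_nth)

lemma continuous_on_grad:
  "smooth_on UNIV f \<Longrightarrow> continuous_on UNIV (grad f)"
  by (subst continuous_on_componentwise)
     (auto simp: Basis_vec_def inner_axis intro: smooth_on_UNIV_continuous smooth_on_UNIV_grad)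

lemma test_function_iff:
  "test_function \<psi> \<longleftrightarrow> smooth_on UNIV \<psi> \<and> bounded {x. \<psi> x \<noteq> 0}"
  by (simp add: test_function_def)

lemma test_function_smooth: "test_function \<psi> \<Longrightarrow> smooth_on UNIV \<psi>"
  by (simp add: test_function_def)

lemma test_function_vanishes:
  assumes "test_function \<psi>"
  shows "\<exists>r. \<forall>x. norm x > r \<longrightarrow> \<psi> x = 0"
proof -
  obtain r where r: "\<And>x. \<psi> x \<noteq> 0 \<Longrightarrow> norm x \<le> r"
    using assms unfolding test_function_iff bounded_iff by blast
  have "\<psi> x = 0" if "norm x > r" for x using r[of x] that by fastforce
  then show ?thesis by blast
qed

lemma test_functionI:
  assumes "smooth_on UNIV \<psi>" "\<And>x. norm x > r \<Longrightarrow> \<psi> x = 0"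
  shows "test_function \<psi>"
proof -
  have "\<forall>x\<in>{x. \<psi> x \<noteq> 0}. norm x \<le> r"
    using assms(2) by (metis (mono_tags) mem_Collect_eq not_le)
  then show ?thesis unfolding test_function_iff bounded_iff using assms(1) by blast
qed

lemma test_function_grad:
  assumes "test_function \<psi>"
  shows "test_function (\<lambda>x. grad \<psi> x $ k)"
proof -
  obtain r where r: "\<And>x. norm x > r \<Longrightarrow> \<psi> x = 0" using test_function_vanishes[OF assms] by blast
  have "grad \<psi> x $ k = 0" if "norm x > r" for x
  proof -
    have "open {x::real^'a. norm x > r}" by (intro open_Collect_less continuous_intros)
    then have "(\<psi> has_derivative (\<lambda>_. 0)) (at x)"
      using that r by (intro has_derivative_transform_within_open[OF has_derivative_const[of 0]]) auto
    from grad_eqI[OF this] show ?thesis by simp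
  qed
  then show ?thesis
    using assms by (blast intro: test_functionI smooth_on_UNIV_grad test_function_smooth)
qed

lemma test_function_mult_smooth:
  assumes "smooth_on UNIV f" "test_function \<psi>"
  shows "test_function (\<lambda>x. f x * \<psi> x)"
proof -
  obtain r where r: "\<And>x. norm x > r \<Longrightarrow> \<psi> x = 0" using test_function_vanishes[OF assms(2)] by blast
  have "smooth_on UNIV (\<lambda>x. f x * \<psi> x)"
    using assms(1) test_function_smooth[OF assms(2)] by (rule smooth_on_UNIV_mult)
  then show ?thesis by (rule test_functionI[of _ r]) (simp add: r)
qed

lemma test_function_bounded:
  assumes "test_function \<psi>"
  shows "\<exists>M. \<forall>x. \<bar>\<psi> x\<bar> \<le> M"
proof -
  obtain r where r: "\<And>x. norm x > r \<Longrightarrow> \<psi> x = 0" using test_function_vanishes[OF assms] by blast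
  have "bounded (\<psi> ` cball 0 r)"
    by (intro compact_imp_bounded compact_continuous_image compact_cball continuous_on_subset[OF
        smooth_on_UNIV_continuous[OF test_function_smooth[OF assms]]]) auto
  then obtain M where M: "\<forall>x\<in>cball 0 r. \<bar>\<psi> x\<bar> \<le> M" by (auto simp: bounded_iff)
  have "\<bar>\<psi> x\<bar> \<le> max M 0" for x using bspec[OF M, of x] r[of x] by fastforce
  then show ?thesis by blast
qed

section \<open>Integration against test functions\<close>

lemma continuous_imp_locally_integrable:
  fixes f :: "'a::euclidean_space \<Rightarrow> 'b::euclidean_space"
  assumes "continuous_on UNIV f"
  shows "locally_integrable f"
  unfolding locally_integrable_def
proof (intro allI impI)
  fix K :: "'a set" assume K: "compact K"
  obtain a where "K \<subseteq> cbox (-a) a"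
    using bounded_subset_cbox_symmetric[OF compact_imp_bounded[OF K]] by blast
  moreover have "f absolutely_integrable_on cbox (-a) a"
    by (rule absolutely_integrable_continuous) (use assms continuous_on_subset in blast)
  ultimately show "f absolutely_integrable_on K"
    using K by (meson set_integrable_subset lmeasurable_compact fmeasurableD)
qed

lemma integrable_test_function_scaleR:
  fixes u :: "real^'n::finite \<Rightarrow> 'b::euclidean_space"
  assumes "locally_integrable u" "test_function \<psi>"
  shows "integrable lebesgue (\<lambda>x. \<psi> x *\<^sub>R u x)"
proof -
  obtain r where r: "\<And>x. norm x > r \<Longrightarrow> \<psi> x = 0" using test_function_vanishes[OF assms(2)] by blast
  obtain M where M: "\<And>x. \<bar>\<psi> x\<bar> \<le> M" using test_function_bounded[OF assms(2)] by blast
  have c: "continuous_on UNIV \<psi>"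
    using assms(2) by (intro smooth_on_UNIV_continuous test_function_smooth)
  have "(\<lambda>x. \<psi> x *\<^sub>R u x) absolutely_integrable_on cball 0 r"
  proof (rule absolutely_integrable_bounded_measurable_product[where h = scaleR])
    show "bilinear (scaleR :: real \<Rightarrow> 'b \<Rightarrow> 'b)"
      using bilinear_conv_bounded_bilinear bounded_bilinear_scaleR by blast
    show "\<psi> \<in> borel_measurable (lebesgue_on (cball 0 r))"
      by (rule continuous_imp_measurable_on_sets_lebesgue)
         (use c continuous_on_subset in auto)
    show "bounded (\<psi> ` cball 0 r)" using M by (auto simp: bounded_iff)
    show "u absolutely_integrable_on cball 0 r"
      using assms(1) by (simp add: locally_integrable_def)
  qed auto
  moreover have "(\<lambda>x. indicator (cball 0 r) x *\<^sub>R \<psi> x *\<^sub>R u x) = (\<lambda>x. \<psi> x *\<^sub>R u x)"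
    using r by (force simp: indicator_def)
  ultimately show ?thesis by (simp add: set_integrable_def)
qed

lemma integrable_test_function:
  "test_function \<psi> \<Longrightarrow> integrable lebesgue \<psi>"
  using integrable_test_function_scaleR[OF continuous_imp_locally_integrable[OF
      continuous_on_const[of _ "1::real"]]] by simp

lemma lebesgue_integral_translate:
  fixes f :: "'a::euclidean_space \<Rightarrow> real"
  assumes "continuous_on UNIV f"
  shows "(LINT x|lebesgue. f (x + c)) = (LINT x|lebesgue. f x)" (is ?eq)
    and "integrable lebesgue f \<Longrightarrow> integrable lebesgue (\<lambda>x. f (x + c))"
proof -
  have m: "f \<in> borel_measurable borel"
    using assms by (rule borel_measurable_continuous_onI)
  have m': "(\<lambda>x. f (x + c)) \<in> borel_measurable borel"
    by (intro borel_measurable_continuous_onI continuous_on_compose2[OF assms] continuous_intros) auto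
  have "(LINT x|lebesgue. f x) = (LINT x|distr lborel borel ((+) c). f x)"
    using m by (simp add: integral_completion lborel_distr_plus)
  also have "\<dots> = (LINT x|lborel. f (c + x))"
    using m by (intro integral_distr) auto
  also have "\<dots> = (LINT x|lebesgue. f (x + c))"
    using m' by (simp add: integral_completion add.commute)
  finally show ?eq by simp
  assume "integrable lebesgue f"
  then have "integrable (distr lborel borel ((+) c)) f"
    using m by (simp add: integrable_completion lborel_distr_plus)
  then have "integrable lborel (\<lambda>x. f (c + x))"
    using m by (subst (asm) integrable_distr_eq) auto
  then show "integrable lebesgue (\<lambda>x. f (x + c))"
    using m' by (simp add: integrable_completion add.commute)
qed

lemma has_real_derivative_along_axis:
  assumes "f differentiable (at (x + t *\<^sub>R axis k 1))"
  shows "((\<lambda>t. f (x + t *\<^sub>R axis k 1)) has_real_derivative grad f (x + t *\<^sub>R axis k 1) $ k) (at t)"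
proof -
  let ?y = "x + t *\<^sub>R axis k 1"
  have f: "(f has_derivative frechet_derivative f (at ?y)) (at ?y)"
    using assms frechet_derivative_works by blast
  have "((\<lambda>t. x + t *\<^sub>R axis k 1) has_derivative (\<lambda>s. s *\<^sub>R axis k 1)) (at t)"
    by (auto intro!: derivative_eq_intros)
  from has_derivative_compose[OF this f]
  have "((\<lambda>t. f (x + t *\<^sub>R axis k 1)) has_derivative
          (\<lambda>s. frechet_derivative f (at ?y) (s *\<^sub>R axis k 1))) (at t)" .
  moreover have "frechet_derivative f (at ?y) (s *\<^sub>R axis k 1) = grad f ?y $ k * s" for s
    using linear_cmul[OF has_derivative_linear[OF f]] by (simp add: grad_def mult.commute)
  ultimately show ?thesis by (simp add: has_field_derivative_def)
qed

text \<open>The integral of \<open>\<psi> (x + t e)\<close> does not depend on \<open>t\<close>. Its derivative in \<open>t\<close>, taken under the integral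
  sign, is the integral of the partial derivative. The mean value theorem bounds the difference
  quotients by a multiple of the indicator of one ball, so dominated convergence applies.\<close>

lemma integral_grad_test_function:
  fixes \<psi> :: "real^'n::finite \<Rightarrow> real"
  assumes "test_function \<psi>"
  shows "(LINT x|lebesgue. grad \<psi> x $ k) = 0"
proof -
  define e :: "real^'n" where "e = axis k 1"
  define t where "t n = inverse (real (Suc n))" for n
  have t: "t n > 0" "t n \<le> 1" for n by (auto simp: t_def field_simps)
  define F where "F n x = (\<psi> (x + t n *\<^sub>R e) - \<psi> x) / t n" for n x
  have c: "continuous_on UNIV \<psi>"
    using assms by (intro smooth_on_UNIV_continuous test_function_smooth)
  have d: "((\<lambda>t. \<psi> (x + t *\<^sub>R e)) has_real_derivative grad \<psi> (x + t *\<^sub>R e) $ k) (at t)" for x t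
    unfolding e_def using assms
    by (intro has_real_derivative_along_axis smooth_on_UNIV_differentiable test_function_smooth)
  obtain r where r: "\<And>x. norm x > r \<Longrightarrow> \<psi> x = 0" using test_function_vanishes[OF assms] by blast
  obtain M where M: "\<And>x. \<bar>grad \<psi> x $ k\<bar> \<le> M"
    using test_function_bounded[OF test_function_grad[OF assms]] by blast
  have lim: "(\<lambda>n. F n x) \<longlonglongrightarrow> grad \<psi> x $ k" for x
  proof -
    have "((\<lambda>h. (\<psi> (x + h *\<^sub>R e) - \<psi> x) / h) \<longlongrightarrow> grad \<psi> x $ k) (at 0)"
      using d[of x 0] by (simp add: has_field_derivative_iff)
    moreover have "filterlim t (at 0) sequentially"
      unfolding filterlim_at t_def using LIMSEQ_inverse_real_of_nat by auto
    ultimately show ?thesis unfolding F_def by (rule filterlim_compose)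
  qed
  have bound: "norm (F n x) \<le> M * indicator (cball 0 (r + 1)) x" for n x
  proof (cases "norm x \<le> r + 1")
    case True
    obtain z where "\<psi> (x + t n *\<^sub>R e) - \<psi> (x + 0 *\<^sub>R e) = (t n - 0) * grad \<psi> (x + z *\<^sub>R e) $ k"
      using MVT2[OF t(1) d] by blast
    then have "F n x = grad \<psi> (x + z *\<^sub>R e) $ k"
      using t(1)[of n] by (simp add: F_def)
    with M True show ?thesis by (simp add: indicator_def)
  next
    case False
    \<comment> \<open>The step is at most one, so outside the enlarged ball both sampled values vanish.\<close>
    have "norm x \<le> norm (x + t n *\<^sub>R e) + norm (t n *\<^sub>R e)"
      by (metis add_diff_cancel_right' norm_triangle_ineq4)
    moreover have "norm (t n *\<^sub>R e) \<le> 1" using t[of n] by (simp add: e_def)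
    ultimately have "norm (x + t n *\<^sub>R e) > r" using False by linarith
    then show ?thesis using r False by (simp add: F_def)
  qed
  have int: "integrable lebesgue \<psi>" using assms by (rule integrable_test_function)
  have ct: "continuous_on UNIV (\<lambda>x. \<psi> (x + v))" for v
    by (intro continuous_on_compose2[OF c] continuous_intros) auto
  have "(LINT x|lebesgue. F n x) = 0" for n
    unfolding F_def using int lebesgue_integral_translate[OF c] by simp
  moreover have "(\<lambda>n. LINT x|lebesgue. F n x) \<longlonglongrightarrow> (LINT x|lebesgue. grad \<psi> x $ k)"
  proof (rule integral_dominated_convergence)
    show "(\<lambda>x. grad \<psi> x $ k) \<in> borel_measurable lebesgue"
      using integrable_test_function[OF test_function_grad[OF assms]] by blast
    show "F n \<in> borel_measurable lebesgue" for n
      unfolding F_def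
      using borel_measurable_continuous_onI[OF c] borel_measurable_continuous_onI[OF ct]
      by (intro borel_measurable_divide borel_measurable_diff measurable_completion) auto
    have "integrable lebesgue (indicator (cball (0::real^'n) (r + 1)) :: real^'n \<Rightarrow> real)"
      using lmeasurable_cball[of 0 "r + 1"]
      by (intro integrable_real_indicator) (auto simp: fmeasurable_def)
    then show "integrable lebesgue (\<lambda>x. M * indicator (cball (0::real^'n) (r + 1)) x)"
      by (intro integrable_mult_right)
  qed (use lim bound in auto)
  ultimately show ?thesis by (simp add: LIMSEQ_const_iff)
qed

section \<open>Weak gradients\<close>

lemma vec_integral_nth:
  fixes f :: "'a \<Rightarrow> real^'n::finite"
  assumes "integrable M f"
  shows "(\<integral>x. f x \<partial>M) $ k = (\<integral>x. f x $ k \<partial>M)"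
  using integral_bounded_linear[OF bounded_linear_vec_nth assms] by simp

lemma integrable_vecI:
  fixes f :: "'a \<Rightarrow> real^'n::finite"
  assumes "\<And>k. integrable M (\<lambda>x. f x $ k)"
  shows "integrable M f"
proof -
  have "integrable M (\<lambda>x. \<Sum>k\<in>UNIV. (f x $ k) *\<^sub>R axis k (1::real))"
    using assms by (intro Bochner_Integration.integrable_sum integrable_scaleR_left)
  moreover have "(\<Sum>k\<in>UNIV. (f x $ k) *\<^sub>R axis k (1::real)) = f x" for x
    by (simp add: vec_eq_iff axis_def if_distrib cong: if_cong)
  ultimately show ?thesis by simp
qed

lemma locally_integrable_nth:
  fixes g :: "real^'m::finite \<Rightarrow> real^'n::finite"
  assumes "locally_integrable g"
  shows "locally_integrable (\<lambda>x. g x $ k)"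
  unfolding locally_integrable_def
proof (intro allI impI)
  fix K :: "(real^'m) set" assume "compact K"
  then have "set_integrable lebesgue K g" using assms by (simp add: locally_integrable_def)
  then show "set_integrable lebesgue K (\<lambda>x. g x $ k)"
    unfolding set_integrable_def
    using integrable_bounded_linear[OF bounded_linear_vec_nth, of lebesgue _ k] by fastforce
qed

lemma locally_integrable_add:
  "locally_integrable u \<Longrightarrow> locally_integrable v \<Longrightarrow> locally_integrable (\<lambda>x. u x + v x)"
  unfolding locally_integrable_def by (auto intro: set_integral_add)

lemma integrable_mult_test_function:
  assumes "locally_integrable u" "test_function \<psi>"
  shows "integrable lebesgue (\<lambda>x. u x * \<psi> x)"
  using integrable_test_function_scaleR[OF assms] by (simp add: mult.commute)

text \<open>Componentwise form of the definition. The integral of a vector field that is not integrable has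
  no useful components, so the equivalence uses that local integrability makes both sides integrable.\<close>

lemma has_weak_gradient_iff:
  "has_weak_gradient u g \<longleftrightarrow> locally_integrable u \<and> locally_integrable g \<and>
    (\<forall>\<psi> k. test_function \<psi> \<longrightarrow>
      (LINT x|lebesgue. u x * grad \<psi> x $ k) = - (LINT x|lebesgue. g x $ k * \<psi> x))"
proof -
  have "(LINT x|lebesgue. u x *\<^sub>R grad \<psi> x) = - (LINT x|lebesgue. \<psi> x *\<^sub>R g x) \<longleftrightarrow>
      (\<forall>k. (LINT x|lebesgue. u x * grad \<psi> x $ k) = - (LINT x|lebesgue. g x $ k * \<psi> x))"
    if "locally_integrable u" "locally_integrable g" "test_function \<psi>" for \<psi>
  proof -
    have "integrable lebesgue (\<lambda>x. \<psi> x *\<^sub>R g x)"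
      using that by (intro integrable_test_function_scaleR)
    moreover have "integrable lebesgue (\<lambda>x. u x *\<^sub>R grad \<psi> x)"
      using that by (intro integrable_vecI)
        (simp add: integrable_mult_test_function test_function_grad)
    ultimately show ?thesis
      by (simp add: vec_eq_iff vec_integral_nth mult.commute)
  qed
  then show ?thesis unfolding has_weak_gradient_def by blast
qed

lemma has_weak_gradient_add:
  assumes "has_weak_gradient u g" "has_weak_gradient v h"
  shows "has_weak_gradient (\<lambda>x. u x + v x) (\<lambda>x. g x + h x)"
  using assms unfolding has_weak_gradient_iff
  by (auto simp: locally_integrable_add distrib_right integrable_mult_test_function
      test_function_grad locally_integrable_nth)

lemma integral_by_parts:
  assumes "smooth_on UNIV u" "test_function \<psi>"
  shows "(LINT x|lebesgue. u x * grad \<psi> x $ k) = - (LINT x|lebesgue. grad u x $ k * \<psi> x)"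
proof -
  have d: "grad (\<lambda>x. u x * \<psi> x) x $ k = u x * grad \<psi> x $ k + \<psi> x * grad u x $ k" for x
    using assms by (simp add: grad_mult smooth_on_UNIV_differentiable test_function_smooth)
  have i: "integrable lebesgue (\<lambda>x. u x * grad \<psi> x $ k)" "integrable lebesgue (\<lambda>x. \<psi> x * grad u x $ k)"
    using integrable_test_function[OF test_function_mult_smooth[OF assms(1) test_function_grad[OF assms(2)]]]
      integrable_test_function[OF test_function_mult_smooth[OF smooth_on_UNIV_grad[OF assms(1)] assms(2)]]
    by (simp_all add: mult.commute)
  have "(LINT x|lebesgue. grad (\<lambda>x. u x * \<psi> x) x $ k) = 0"
    using assms by (intro integral_grad_test_function test_function_mult_smooth)
  with i show ?thesis unfolding d by (simp add: mult.commute)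
qed

lemma has_weak_gradient_smooth:
  assumes "smooth_on UNIV u"
  shows "has_weak_gradient u (grad u)"
  unfolding has_weak_gradient_iff
  using assms by (auto intro: continuous_imp_locally_integrable smooth_on_UNIV_continuous
        continuous_on_grad integral_by_parts)

lemma has_weak_gradient_weak_gradient:
  "has_weak_gradient u g \<Longrightarrow> has_weak_gradient u (weak_gradient u)"
  unfolding weak_gradient_def by (rule someI[of "has_weak_gradient u"])

lemma H1_loc_smooth:
  assumes "smooth_on UNIV u"
  shows "H1_loc u"
  unfolding H1_loc_def
proof (intro conjI exI)
  have c: "continuous_on UNIV u" using assms by (rule smooth_on_UNIV_continuous)
  show "u \<in> borel_measurable lebesgue"
    using borel_measurable_continuous_onI[OF c] by (simp add: measurable_completion)
  show "locally_integrable (\<lambda>x. (u x)\<^sup>2)"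
    using c by (intro continuous_imp_locally_integrable continuous_intros)
  show "has_weak_gradient u (grad u)" using assms by (rule has_weak_gradient_smooth)
  show "locally_integrable (\<lambda>x. (norm (grad u x))\<^sup>2)"
    using continuous_on_grad[OF assms] by (intro continuous_imp_locally_integrable continuous_intros)
qed

section \<open>Neutral inclusions\<close>

lemma monomial_order_1:
  assumes "mi_order j = 1"
  obtains k where "monomial j = (\<lambda>x. x $ k)"
proof -
  obtain k where k: "j k = 1" "\<And>l. l \<noteq> k \<Longrightarrow> j l = 0"
    using assms sum_eq_1_iff[OF finite, of j UNIV] unfolding mi_order_def by auto
  have "(x $ l) ^ j l = (if l = k then x $ k else 1)" for x :: "real^'a" and l
    using k by auto
  then have "monomial j = (\<lambda>x. x $ k)"
    by (auto simp: monomial_def fun_eq_iff)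
  then show ?thesis by (rule that)
qed

lemma inner_grad_nth: "v \<bullet> grad (\<lambda>x. x $ k) x = v $ k"
  by (simp add: inner_vec_def grad_nth if_distrib cong: if_cong)

text \<open>For smooth \<open>D\<close> the components of \<open>D \<nabla> \<psi>\<close> are again test functions. Hence the weak form of
  \<open>\<nabla> \<cdot> (D \<nabla> \<phi>)\<close> depends on \<open>\<phi>\<close> alone, whichever representative of its weak gradient \<open>g\<close> is taken.\<close>

lemma integral_flux_eq:
  assumes \<phi>: "has_weak_gradient \<phi> g" and D: "smooth_on UNIV D" and \<psi>: "test_function \<psi>"
  shows "(LINT x|lebesgue. (D x *\<^sub>R g x) \<bullet> grad \<psi> x) =
    - (LINT x|lebesgue. \<phi> x * (\<Sum>k\<in>UNIV. grad (\<lambda>y. D y * grad \<psi> y $ k) x $ k))"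
proof -
  have t: "test_function (\<lambda>y. D y * grad \<psi> y $ k)" for k
    using D \<psi> by (intro test_function_mult_smooth test_function_grad)
  have li: "locally_integrable \<phi>" "locally_integrable g"
    using \<phi> by (auto simp: has_weak_gradient_def)
  have "(LINT x|lebesgue. (D x *\<^sub>R g x) \<bullet> grad \<psi> x) =
      (LINT x|lebesgue. (\<Sum>k\<in>UNIV. g x $ k * (D x * grad \<psi> x $ k)))"
    by (simp add: inner_vec_def algebra_simps)
  also have "\<dots> = (\<Sum>k\<in>UNIV. (LINT x|lebesgue. g x $ k * (D x * grad \<psi> x $ k)))"
    using t li by (intro Bochner_Integration.integral_sum integrable_mult_test_function
        locally_integrable_nth)
  also have "\<dots> = (\<Sum>k\<in>UNIV. - (LINT x|lebesgue. \<phi> x * grad (\<lambda>y. D y * grad \<psi> y $ k) x $ k))"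
    using \<phi> t by (simp add: has_weak_gradient_iff)
  also have "\<dots> = - (LINT x|lebesgue. (\<Sum>k\<in>UNIV. \<phi> x * grad (\<lambda>y. D y * grad \<psi> y $ k) x $ k))"
    using integrable_mult_test_function[OF li(1) test_function_grad[OF t]]
    by (subst Bochner_Integration.integral_sum) (simp_all add: sum_negf)
  finally show ?thesis by (simp add: sum_distrib_left)
qed

text \<open>Moving the divergence to \<open>\<psi>\<close> replaces the chosen weak gradient by the classical one; moving it back
  to \<open>\<phi>\<close> then makes the equation for \<open>\<phi>\<close> available pointwise.\<close>

lemma is_corrector_neutral:
  fixes D1 :: "real^'n::finite \<Rightarrow> real"
  assumes D1: "test_function D1" and \<phi>: "test_function \<phi>"
    and div: "\<And>x. (\<Sum>k\<in>UNIV. grad (\<lambda>y. (d0 + D1 y) * grad \<phi> y $ k) x $ k) = - grad D1 x $ l"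
    and j: "monomial j = (\<lambda>x. x $ l)"
  shows "is_corrector d0 B D1 j \<phi>"
  unfolding is_corrector_def
proof (intro conjI allI impI)
  have s: "smooth_on UNIV \<phi>" "smooth_on UNIV D1" using \<phi> D1 by (auto intro: test_function_smooth)
  have sD: "smooth_on UNIV (\<lambda>x. d0 + D1 x)"
    by (intro smooth_on_UNIV_add smooth_on_UNIV_const s)
  show H1: "H1_loc \<phi>" using s(1) by (rule H1_loc_smooth)
  show "smooth_on (- closure B) \<phi>"
    using s(1) Ck_on_subset unfolding smooth_on_def by blast
  obtain r where r: "\<And>x. norm x > r \<Longrightarrow> \<phi> x = 0" using test_function_vanishes[OF \<phi>] by blast
  have "eventually (\<lambda>x. \<phi> x = 0) at_infinity"
    unfolding eventually_at_infinity using r by (intro exI[of _ "r + 1"]) auto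
  then show "\<phi> \<in> O[at_infinity](\<lambda>x. norm x powr (1 - real CARD('n)))"
    by (intro landau_o.bigI[of 1]) (auto elim!: eventually_mono)
  fix \<psi> :: "real^'n \<Rightarrow> real" assume \<psi>: "test_function \<psi>"
  have wg: "has_weak_gradient \<phi> (weak_gradient \<phi>)"
    using has_weak_gradient_smooth[OF s(1)] by (rule has_weak_gradient_weak_gradient)
  have e: "grad (monomial j) x \<bullet> v = v $ l" for x v :: "real^'n"
    unfolding j by (simp add: inner_grad_nth inner_commute)
  have t: "test_function (\<lambda>y. (d0 + D1 y) * grad \<phi> y $ k)" for k
    using sD \<phi> by (intro test_function_mult_smooth test_function_grad)
  have "(LINT x|lebesgue. ((d0 + D1 x) *\<^sub>R weak_gradient \<phi> x) \<bullet> grad \<psi> x) =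
      (LINT x|lebesgue. ((d0 + D1 x) *\<^sub>R grad \<phi> x) \<bullet> grad \<psi> x)"
    using integral_flux_eq[OF wg sD \<psi>] integral_flux_eq[OF has_weak_gradient_smooth[OF s(1)] sD \<psi>]
    by simp
  also have "\<dots> = (LINT x|lebesgue. ((d0 + D1 x) *\<^sub>R grad \<psi> x) \<bullet> grad \<phi> x)"
    by (simp add: inner_commute)
  also have "\<dots> = (LINT x|lebesgue. \<psi> x * grad D1 x $ l)"
    using integral_flux_eq[OF has_weak_gradient_smooth[OF test_function_smooth[OF \<psi>]] sD \<phi>]
    by (simp add: div)
  also have "\<dots> = - (LINT x|lebesgue. D1 x * grad \<psi> x $ l)"
    using integral_by_parts[OF s(2) \<psi>, of l] by (simp add: mult.commute)
  finally show "distr_div (\<lambda>x. (d0 + D1 x) *\<^sub>R weak_gradient \<phi> x) \<psi>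
      = - distr_div (\<lambda>x. D1 x *\<^sub>R grad (monomial j) x) \<psi>"
    by (simp add: distr_div_def e)
qed

text \<open>The entry is \<open>- \<integral> (x\<^sub>m + \<Phi>) \<partial>\<^sub>l D1\<close> for the chosen corrector \<open>\<Phi>\<close>. By \<open>div\<close>, its two parts can be expressed
  through \<open>\<nabla> \<cdot> (D \<nabla> \<phi>)\<close>. The corrector equation tested with \<open>\<phi>\<close> turns the part with \<open>\<Phi>\<close> into
  \<open>\<integral> D1 \<partial>\<^sub>m \<phi>\<close>, and integration by parts turns the part with \<open>x\<^sub>m\<close> into its negative. The corrector \<open>\<phi>'\<close>
  serves only to make the choice in \<open>corrector\<close> meaningful.\<close>

lemma polarization_tensor_neutral:
  fixes D1 :: "real^'n::finite \<Rightarrow> real"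
  assumes D1: "test_function D1" and supp: "\<And>x. x \<notin> B \<Longrightarrow> D1 x = 0"
    and \<phi>: "test_function \<phi>"
    and div: "\<And>x. (\<Sum>k\<in>UNIV. grad (\<lambda>y. (d0 + D1 y) * grad \<phi> y $ k) x $ k) = - grad D1 x $ l"
    and i: "monomial i = (\<lambda>x. x $ l)" and j: "monomial j = (\<lambda>x. x $ m)"
    and ex: "is_corrector d0 B D1 j \<phi>'"
  shows "polarization_tensor d0 B D1 i j = 0"
proof -
  define \<Phi> where "\<Phi> = corrector d0 B D1 j"
  define w where "w = weak_gradient (\<lambda>y. monomial j y + \<Phi> y)"
  have \<Phi>: "is_corrector d0 B D1 j \<Phi>"
    unfolding \<Phi>_def corrector_def using ex by (rule someI[of "is_corrector d0 B D1 j"])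
  then have wg: "has_weak_gradient \<Phi> (weak_gradient \<Phi>)"
    unfolding is_corrector_def H1_loc_def using has_weak_gradient_weak_gradient by blast
  have x: "smooth_on UNIV (\<lambda>x::real^'n. x $ m)" by (rule smooth_on_UNIV_nth)
  have w: "has_weak_gradient (\<lambda>y. y $ m + \<Phi> y) w"
    unfolding w_def j
    using has_weak_gradient_add[OF has_weak_gradient_smooth[OF x] wg]
    by (rule has_weak_gradient_weak_gradient)
  have sD: "smooth_on UNIV (\<lambda>x. d0 + D1 x)"
    by (intro smooth_on_UNIV_add smooth_on_UNIV_const test_function_smooth D1)
  note e = inner_grad_nth
  have li: "locally_integrable \<Phi>" using wg by (simp add: has_weak_gradient_def)
  have tg: "test_function (\<lambda>x. grad D1 x $ l)" "test_function (\<lambda>x. grad \<phi> x $ m)"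
    using D1 \<phi> by (auto intro: test_function_grad)
  have "polarization_tensor d0 B D1 i j = (LINT x|lebesgue. w x $ l * D1 x)"
    unfolding polarization_tensor_def set_lebesgue_integral_def w_def[symmetric] \<Phi>_def[symmetric] i e
    by (intro Bochner_Integration.integral_cong) (auto simp: indicator_def supp)
  also have "\<dots> = - (LINT x|lebesgue. (x $ m + \<Phi> x) * grad D1 x $ l)"
    using w D1 by (simp add: has_weak_gradient_iff)
  also have "\<dots> = - (LINT x|lebesgue. x $ m * grad D1 x $ l) - (LINT x|lebesgue. \<Phi> x * grad D1 x $ l)"
    using integrable_mult_test_function[OF li tg(1)]
      integrable_mult_test_function[OF continuous_imp_locally_integrable[OF smooth_on_UNIV_continuous[OF x]] tg(1)]
    by (simp add: distrib_right)
  also have "(LINT x|lebesgue. \<Phi> x * grad D1 x $ l) = - (LINT x|lebesgue. D1 x * grad \<phi> x $ m)"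
  proof -
    have "(LINT x|lebesgue. \<Phi> x * grad D1 x $ l) =
        (LINT x|lebesgue. ((d0 + D1 x) *\<^sub>R weak_gradient \<Phi> x) \<bullet> grad \<phi> x)"
      using integral_flux_eq[OF wg sD \<phi>] by (simp add: div)
    also have "\<dots> = - (LINT x|lebesgue. D1 x * (grad \<phi> x \<bullet> grad (monomial j) x))"
    proof -
      have "distr_div (\<lambda>x. (d0 + D1 x) *\<^sub>R weak_gradient \<Phi> x) \<phi>
          = - distr_div (\<lambda>x. D1 x *\<^sub>R grad (monomial j) x) \<phi>"
        using \<Phi> \<phi> unfolding is_corrector_def by blast
      then show ?thesis unfolding distr_div_def by (simp add: inner_commute)
    qed
    finally show ?thesis by (simp add: j e)
  qed
  also have "(LINT x|lebesgue. x $ m * grad D1 x $ l) = (LINT x|lebesgue. D1 x * grad \<phi> x $ m)"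
  proof -
    have "(LINT x|lebesgue. x $ m * grad D1 x $ l) =
        (LINT x|lebesgue. ((d0 + D1 x) *\<^sub>R grad (\<lambda>x. x $ m) x) \<bullet> grad \<phi> x)"
      using integral_flux_eq[OF has_weak_gradient_smooth[OF x] sD \<phi>] by (simp add: div)
    also have "\<dots> = (LINT x|lebesgue. d0 * grad \<phi> x $ m + D1 x * grad \<phi> x $ m)"
      by (simp add: inner_commute e distrib_right)
    also have "\<dots> = d0 * (LINT x|lebesgue. grad \<phi> x $ m) + (LINT x|lebesgue. D1 x * grad \<phi> x $ m)"
      using integrable_test_function[OF tg(2)]
        integrable_test_function[OF test_function_mult_smooth[OF test_function_smooth[OF D1] tg(2)]]
      by simp
    finally show ?thesis using integral_grad_test_function[OF \<phi>] by simp
  qed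
  finally show ?thesis by simp
qed


section \<open>The radial equation\<close>

text \<open>Prescribe \<open>\<alpha> = f' / f\<close> and write \<open>\<kappa> = 1 + 2 s \<alpha>\<close>, so that \<open>f + 2 s f' = \<kappa> f\<close>. The last equation is
  equivalent to \<open>(h \<kappa> f)' = (1 - n) \<alpha> h f\<close>, that is, the logarithm \<open>p\<close> of \<open>h \<kappa> f / d0\<close> has derivative
  \<open>(1 - n) \<alpha> / \<kappa>\<close>. With \<open>f = exp a\<close> this gives \<open>h = d0 exp (p - a) / \<kappa>\<close>. The integration constants are
  fixed by \<open>a = p = 0\<close> at \<open>S\<close>. The difference \<open>p - a\<close> is nonincreasing, and strictly decreasing on
  \<open>(0, S)\<close>; as \<open>\<kappa> \<le> 1 + 2 S\<close>, this bounds \<open>h\<close> away from zero and makes \<open>h 0\<close> larger than \<open>d0\<close>.\<close>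

lemma neutral_profile_exists:
  fixes n d0 S :: real
  assumes n: "n \<ge> 1" and d0: "d0 > 0" and S: "S > 0"
  obtains f f' f'' h h' b where
    "\<And>s. (f has_real_derivative f' s) (at s)" "\<And>s. (f' has_real_derivative f'' s) (at s)"
    "\<And>s. (h has_real_derivative h' s) (at s)"
    "\<And>m. Ck_real m f" "\<And>m. Ck_real m h"
    "\<And>s. s \<ge> S \<Longrightarrow> f s = 1" "\<And>s. s \<ge> S \<Longrightarrow> h s = d0"
    "b > 0" "\<And>s. b \<le> h s" "h 0 \<noteq> d0"
    "\<And>s. h' s * (f s + 2 * s * f' s) + h s * ((n + 2) * f' s + 2 * s * f'' s) = 0"
proof -
  \<comment> \<open>The left factor keeps \<open>\<kappa>\<close> away from zero for negative \<open>s\<close>, so that all profiles are smooth on the whole line.\<close>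
  define \<alpha> where "\<alpha> s = flat 0 s * flat 0 (S - s)" for s
  have C\<alpha>: "Ck_real m \<alpha>" for m
    unfolding \<alpha>_def
    by (intro Ck_real_mult Ck_real_flat Ck_real_compose[of m "flat 0" "\<lambda>s. S - s"]
        Ck_real_diff Ck_real_const Ck_real_ident)
  obtain \<alpha>' where \<alpha>': "\<And>s. (\<alpha> has_real_derivative \<alpha>' s) (at s)"
    using C\<alpha>[of 1] by auto
  have \<alpha>_nonneg: "\<alpha> s \<ge> 0" for s by (simp add: \<alpha>_def flat_nonneg)
  have \<alpha>_le: "\<alpha> s \<le> 1" for s
    using flat_0_le_1 flat_nonneg by (simp add: \<alpha>_def mult_le_one)
  have \<alpha>_pos: "\<alpha> s > 0" if "0 < s" "s < S" for s using that by (simp add: \<alpha>_def flat_pos)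
  have \<alpha>_0: "\<alpha> s = 0" if "s \<le> 0 \<or> s \<ge> S" for s using that by (auto simp: \<alpha>_def flat_def)
  define \<kappa> where "\<kappa> s = 1 + 2 * (s * \<alpha> s)" for s
  have \<kappa>_ge: "\<kappa> s \<ge> 1" for s
    using \<alpha>_nonneg[of s] \<alpha>_0[of s] by (cases "s \<le> 0") (auto simp: \<kappa>_def)
  have \<kappa>_le: "\<kappa> s \<le> 1 + 2 * S" for s
  proof -
    have "s * \<alpha> s \<le> S * 1" if "0 < s" "s < S"
      using that \<alpha>_le[of s] \<alpha>_nonneg[of s] by (intro mult_mono) auto
    then show ?thesis using \<alpha>_0[of s] S by (cases "0 < s \<and> s < S") (auto simp: \<kappa>_def)
  qed
  have \<kappa>_nz: "\<kappa> s \<noteq> 0" for s using \<kappa>_ge[of s] by linarith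
  have C\<kappa>: "Ck_real m \<kappa>" for m
    unfolding \<kappa>_def by (intro Ck_real_add Ck_real_mult Ck_real_const Ck_real_ident C\<alpha>)
  define \<beta> where "\<beta> s = (1 - n) * (\<alpha> s * inverse (\<kappa> s))" for s
  have C\<beta>: "Ck_real m \<beta>" for m
    unfolding \<beta>_def by (intro Ck_real_mult Ck_real_const C\<alpha> Ck_real_inverse C\<kappa> \<kappa>_nz)
  obtain a where a: "\<And>s. (a has_real_derivative \<alpha> s) (at s)" "a S = 0"
    using continuous_antiderivative[of \<alpha> S] C\<alpha>[of 0] by auto
  obtain p where p: "\<And>s. (p has_real_derivative \<beta> s) (at s)" "p S = 0"
    using continuous_antiderivative[of \<beta> S] C\<beta>[of 0] by auto
  have Ca: "Ck_real m a" for m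
    using Ck_real_Suc_D[OF Ck_real_SucI[OF a(1) C\<alpha>]] .
  have Cp: "Ck_real m p" for m
    using Ck_real_Suc_D[OF Ck_real_SucI[OF p(1) C\<beta>]] .
  have const: "g s = g S" if g: "\<And>s. (g has_real_derivative g' s) (at s)"
      and g': "\<And>s. s \<ge> S \<Longrightarrow> g' s = 0" and "s \<ge> S"
    for g g' :: "real \<Rightarrow> real" and s
  proof (cases "s = S")
    case False
    with \<open>s \<ge> S\<close> have "S < s" by simp
    then obtain z where "S < z" "g s - g S = (s - S) * g' z"
      using MVT2[OF _ g, of S s] by blast
    with g'[of z] show ?thesis by simp
  qed simp
  have a0: "a s = 0" if "s \<ge> S" for s
    using const[OF a(1) _ that] \<alpha>_0 a(2) by simp
  have p0: "p s = 0" if "s \<ge> S" for s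
    using const[OF p(1) _ that] \<alpha>_0 p(2) by (simp add: \<beta>_def)
  have dpa: "((\<lambda>s. p s - a s) has_real_derivative \<beta> s - \<alpha> s) (at s)" for s
    by (intro DERIV_diff a p)
  have \<beta>_nonpos: "\<beta> s \<le> 0" for s
    unfolding \<beta>_def using n \<alpha>_nonneg[of s] \<kappa>_ge[of s] by (intro mult_nonpos_nonneg) auto
  have neg: "\<beta> s - \<alpha> s \<le> 0" for s
    using \<beta>_nonpos[of s] \<alpha>_nonneg[of s] by simp
  have mono: "p s - a s \<ge> p t - a t" if "s \<le> t" for s t
    using DERIV_nonpos_imp_nonincreasing[OF that, of "\<lambda>s. p s - a s"] dpa neg by blast
  have pa_nonneg: "p s - a s \<ge> 0" for s
    using mono[of s "max s S"] a0[of "max s S"] p0[of "max s S"] by simp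
  have pa_pos: "p 0 - a 0 > 0"
  proof -
    obtain z where z: "0 < z" "z < S" "(p S - a S) - (p 0 - a 0) = (S - 0) * (\<beta> z - \<alpha> z)"
      using MVT2[OF S dpa] by blast
    have "\<beta> z - \<alpha> z < 0" using \<alpha>_pos[OF z(1,2)] \<beta>_nonpos[of z] by simp
    then have "S * (\<beta> z - \<alpha> z) < 0" using S by (simp add: mult_pos_neg)
    then show ?thesis using z(3) a(2) p(2) by simp
  qed
  define f where "f s = exp (a s)" for s
  define f' where "f' s = \<alpha> s * f s" for s
  define f'' where "f'' s = (\<alpha>' s + \<alpha> s * \<alpha> s) * f s" for s
  define h where "h s = d0 * (exp (p s - a s) * inverse (\<kappa> s))" for s
  define h' where "h' s = h s * (\<beta> s - \<alpha> s - (2 * \<alpha> s + 2 * s * \<alpha>' s) * inverse (\<kappa> s))" for s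
  have df: "(f has_real_derivative f' s) (at s)" for s
    unfolding f_def f'_def by (auto intro!: derivative_eq_intros a)
  have df': "(f' has_real_derivative f'' s) (at s)" for s
    unfolding f'_def f''_def by (auto intro!: derivative_eq_intros df \<alpha>' simp: f'_def algebra_simps)
  have d\<kappa>: "(\<kappa> has_real_derivative 2 * \<alpha> s + 2 * s * \<alpha>' s) (at s)" for s
    unfolding \<kappa>_def by (auto intro!: derivative_eq_intros \<alpha>' simp: algebra_simps)
  have dh: "(h has_real_derivative h' s) (at s)" for s
    unfolding h_def h'_def
    by (rule derivative_eq_intros dpa d\<kappa> \<kappa>_nz refl)+ (simp add: algebra_simps)
  show ?thesis
  proof (rule that[of f f' f'' h h' "d0 / (1 + 2 * S)"])
    show "Ck_real m f" for m
      unfolding f_def by (intro Ck_real_compose[of m exp a] Ck_real_exp Ca)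
    show "Ck_real m h" for m
      unfolding h_def
      by (intro Ck_real_mult Ck_real_const Ck_real_inverse \<kappa>_nz C\<kappa>
          Ck_real_compose[of m exp "\<lambda>s. p s - a s"] Ck_real_exp Ck_real_diff Ca Cp)
    show "f s = 1" if "s \<ge> S" for s using a0[OF that] by (simp add: f_def)
    show "h s = d0" if "s \<ge> S" for s
      using a0[OF that] p0[OF that] \<alpha>_0[of s] that by (simp add: h_def \<kappa>_def)
    show "d0 / (1 + 2 * S) > 0" using d0 S by simp
    show "d0 / (1 + 2 * S) \<le> h s" for s
    proof -
      have "1 * inverse (1 + 2 * S) \<le> exp (p s - a s) * inverse (\<kappa> s)"
        using \<kappa>_ge[of s] \<kappa>_le[of s] pa_nonneg[of s] S
        by (intro mult_mono le_imp_inverse_le) auto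
      from mult_left_mono[OF this, of d0] show ?thesis
        using d0 by (simp add: h_def divide_inverse)
    qed
    show "h 0 \<noteq> d0" using pa_pos d0 by (simp add: h_def \<kappa>_def)
    show "h' s * (f s + 2 * s * f' s) + h s * ((n + 2) * f' s + 2 * s * f'' s) = 0" for s
    proof -
      have fk: "f s + 2 * s * f' s = f s * \<kappa> s" by (simp add: f'_def \<kappa>_def algebra_simps)
      have "(\<beta> s - \<alpha> s - (2 * \<alpha> s + 2 * s * \<alpha>' s) * inverse (\<kappa> s)) * \<kappa> s =
          (1 - n) * \<alpha> s - \<alpha> s * \<kappa> s - (2 * \<alpha> s + 2 * s * \<alpha>' s)"
        using \<kappa>_nz[of s] by (simp add: \<beta>_def algebra_simps)
      then have "h' s * (f s + 2 * s * f' s) =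
          h s * f s * ((1 - n) * \<alpha> s - \<alpha> s * \<kappa> s - (2 * \<alpha> s + 2 * s * \<alpha>' s))"
        unfolding fk h'_def by (simp only: mult.assoc mult.left_commute[of _ "f s"])
      then show ?thesis by (simp add: f'_def f''_def \<kappa>_def algebra_simps)
    qed
  qed (rule df df' dh)+
qed

lemma axis_nth_if: "axis k (1::real) $ l = (if k = l then 1 else 0)"
  by (simp add: axis_def)

lemma has_derivative_radial:
  fixes x :: "real^'n::finite"
  assumes "(h has_real_derivative h') (at (x \<bullet> x))"
  shows "((\<lambda>y. h (y \<bullet> y)) has_derivative (\<lambda>v. h' * (2 * (x \<bullet> v)))) (at x)"
proof -
  have "((\<lambda>y. y \<bullet> y) has_derivative (\<lambda>v. 2 * (x \<bullet> v))) (at x)"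
    by (auto intro!: derivative_eq_intros simp: inner_commute)
  from has_derivative_compose[OF this assms[unfolded has_field_derivative_def]]
  show ?thesis by simp
qed

lemma Ck_on_UNIV_inner_self: "Ck_on m UNIV (\<lambda>x::real^'n::finite. x \<bullet> x)"
proof (cases m)
  case (Suc l)
  have d: "((\<lambda>y. y \<bullet> y) has_derivative (\<lambda>v. 2 * (x \<bullet> v))) (at x)" for x :: "real^'n"
    by (auto intro!: derivative_eq_intros simp: inner_commute)
  have g: "grad (\<lambda>y. y \<bullet> y) x $ k = 2 * x $ k" for x :: "real^'n" and k
    by (simp add: grad_eqI[OF d] inner_axis)
  show ?thesis unfolding Suc
  proof (rule Ck_on_UNIV_SucI)
    show "(\<lambda>x. x \<bullet> x) differentiable (at x)" for x :: "real^'n"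
      using d unfolding differentiable_def by blast
    show "Ck_on l UNIV (\<lambda>x::real^'n. grad (\<lambda>x. x \<bullet> x) x $ k)" for k
      unfolding g by (intro Ck_on_UNIV_mult Ck_on_UNIV_const Ck_on_UNIV_nth)
  qed
qed (auto intro!: continuous_intros)

lemma grad_radial_times_nth:
  fixes x :: "real^'n::finite"
  assumes "(f has_real_derivative f') (at (x \<bullet> x))"
  shows "grad (\<lambda>y. (f (y \<bullet> y) - 1) * y $ l) x $ k =
    2 * (f' * (x $ k * x $ l)) + (f (x \<bullet> x) - 1) * (if k = l then 1 else 0)"
proof -
  have n: "((\<lambda>y. y $ l) has_derivative (\<lambda>v. v $ l)) (at x)"
    by (intro bounded_linear_imp_has_derivative bounded_linear_vec_nth)
  have "((\<lambda>y. (f (y \<bullet> y) - 1) * y $ l) has_derivative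
      (\<lambda>v. (f (x \<bullet> x) - 1) * v $ l + (f' * (2 * (x \<bullet> v)) - 0) * x $ l)) (at x)"
    by (intro has_derivative_mult has_derivative_diff has_derivative_radial assms
        has_derivative_const n)
  from grad_eqI[OF this] show ?thesis by (simp add: inner_axis axis_nth_if)
qed

text \<open>The value is \<open>\<nabla> \<cdot> (D \<nabla> (f x\<^sub>l)) - \<nabla> \<cdot> (D e\<^sub>l)\<close> for \<open>D = h(|x|\<^sup>2)\<close>: the first summand is the left-hand side
  of the radial equation times \<open>2 x\<^sub>l\<close>, the second is \<open>\<partial>\<^sub>l D\<close>.\<close>

lemma div_radial_flux:
  fixes x :: "real^'n::finite"
  assumes df: "\<And>s. (f has_real_derivative f' s) (at s)" and df': "\<And>s. (f' has_real_derivative f'' s) (at s)"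
    and dh: "\<And>s. (h has_real_derivative h' s) (at s)"
  defines "s \<equiv> x \<bullet> x"
  shows "(\<Sum>k\<in>UNIV. grad (\<lambda>y. h (y \<bullet> y) * grad (\<lambda>y. (f (y \<bullet> y) - 1) * y $ l) y $ k) x $ k) =
    2 * x $ l * (h' s * (f s + 2 * s * f' s) + h s * ((real CARD('n) + 2) * f' s + 2 * s * f'' s))
      - 2 * h' s * x $ l"
proof -
  let ?\<delta> = "\<lambda>k. if k = l then 1 else 0 :: real"
  have n: "((\<lambda>y. y $ k) has_derivative (\<lambda>v. v $ k)) (at x)" for k
    by (intro bounded_linear_imp_has_derivative bounded_linear_vec_nth)
  have "grad (\<lambda>y. h (y \<bullet> y) * grad (\<lambda>y. (f (y \<bullet> y) - 1) * y $ l) y $ k) x $ k =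
      (4 * h s * f'' s * x $ l + 4 * h' s * f' s * x $ l) * (x $ k * x $ k)
      + (4 * h s * f' s + 2 * h' s * (f s - 1)) * (?\<delta> k * x $ k) + 2 * h s * f' s * x $ l" for k
  proof -
    let ?P = "\<lambda>y. 2 * (f' (y \<bullet> y) * (y $ k * y $ l)) + (f (y \<bullet> y) - 1) * ?\<delta> k"
    have P: "(?P has_derivative (\<lambda>v. 2 * (f' s * (x $ k * v $ l + v $ k * x $ l)
        + f'' s * (2 * (x \<bullet> v)) * (x $ k * x $ l)) + (f' s * (2 * (x \<bullet> v)) - 0) * ?\<delta> k)) (at x)"
      unfolding s_def
      by (intro has_derivative_add has_derivative_mult_left has_derivative_mult_right has_derivative_mult has_derivative_diff
          has_derivative_const has_derivative_radial df df' n)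
    have "((\<lambda>y. h (y \<bullet> y) * ?P y) has_derivative (\<lambda>v. h s * (2 * (f' s * (x $ k * v $ l + v $ k * x $ l)
        + f'' s * (2 * (x \<bullet> v)) * (x $ k * x $ l)) + (f' s * (2 * (x \<bullet> v)) - 0) * ?\<delta> k)
        + h' s * (2 * (x \<bullet> v)) * ?P x)) (at x)"
      using has_derivative_mult[OF has_derivative_radial[OF dh] P] by (simp add: s_def)
    from grad_eqI[OF this, of k] show ?thesis
      unfolding grad_radial_times_nth[OF df]
      by (cases "k = l") (simp_all add: inner_axis axis_nth_if s_def algebra_simps)
  qed
  moreover have "(\<Sum>k\<in>UNIV. A * (x $ k * x $ k) + B * (?\<delta> k * x $ k) + C) =
      A * s + B * x $ l + real CARD('n) * C" for A B C
  proof -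
    have "(\<Sum>k\<in>UNIV. x $ k * x $ k) = s"
      by (simp add: s_def inner_vec_def)
    moreover have "(\<Sum>k\<in>UNIV. ?\<delta> k * x $ k) = x $ l"
      by (simp add: if_distrib if_distribR cong: if_cong)
    ultimately show ?thesis
      by (simp add: sum.distrib flip: sum_distrib_left)
  qed
  ultimately show ?thesis by (simp only:) (simp add: algebra_simps)
qed

section \<open>A radial perturbation invisible at first order\<close>

theorem proposition2p12:
  fixes d0 R :: real
  assumes "CARD('n::finite) \<ge> 2" and "d0 > 0" and "R > 0"
  shows "\<exists>D1 :: real^'n \<Rightarrow> real.
           admissible d0 (ball 0 R) D1 \<and> spherically_symmetric D1 \<and>
           \<not> (AE x in lebesgue. D1 x = 0) \<and>
           (\<forall>i j. mi_order i = 1 \<and> mi_order j = 1 \<longrightarrow>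
                  polarization_tensor d0 (ball 0 R) D1 i j = 0)"
proof -
  have n: "real CARD('n) \<ge> 1" and S: "R\<^sup>2 > 0" using assms by auto
  obtain f f' f'' h h' b where
    df: "\<And>s. (f has_real_derivative f' s) (at s)" and df': "\<And>s. (f' has_real_derivative f'' s) (at s)"
    and dh: "\<And>s. (h has_real_derivative h' s) (at s)"
    and Cf: "\<And>m. Ck_real m f" and Ch: "\<And>m. Ck_real m h"
    and f1: "\<And>s. s \<ge> R\<^sup>2 \<Longrightarrow> f s = 1" and h1: "\<And>s. s \<ge> R\<^sup>2 \<Longrightarrow> h s = d0"
    and b: "b > 0" and lower: "\<And>s. b \<le> h s"
    and h0: "h 0 \<noteq> d0"
    and ode: "\<And>s. h' s * (f s + 2 * s * f' s)
        + h s * ((real CARD('n) + 2) * f' s + 2 * s * f'' s) = 0"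
    using neutral_profile_exists[OF n \<open>d0 > 0\<close> S] by metis
  define D1 :: "real^'n \<Rightarrow> real" where "D1 x = h (x \<bullet> x) - d0" for x
  define \<phi> :: "'n \<Rightarrow> real^'n \<Rightarrow> real" where "\<phi> l x = (f (x \<bullet> x) - 1) * x $ l" for l x
  have out: "x \<bullet> x \<ge> R\<^sup>2" if "norm x \<ge> R" for x :: "real^'n"
    using that \<open>R > 0\<close> by (simp add: power2_norm_eq_inner[symmetric] power_mono)
  \<comment> \<open>Sums instead of differences, to match the closure rules.\<close>
  have "smooth_on UNIV (\<lambda>x. h (x \<bullet> x) + (- d0))" "smooth_on UNIV (\<lambda>x. (f (x \<bullet> x) + (- 1)) * x $ l)"
    for l :: 'n
    unfolding smooth_on_def
    by (intro allI Ck_on_UNIV_add Ck_on_UNIV_mult Ck_on_UNIV_const Ck_on_UNIV_nth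
        Ck_on_UNIV_compose[of _ h "\<lambda>x. x \<bullet> x"] Ck_on_UNIV_compose[of _ f "\<lambda>x. x \<bullet> x"]
        Ck_on_UNIV_inner_self Cf Ch)+
  then have sm: "smooth_on UNIV D1" "smooth_on UNIV (\<phi> l)" for l
    by (simp_all add: D1_def[abs_def] \<phi>_def[abs_def])
  have D1: "test_function D1"
    by (rule test_functionI[of _ R]) (use sm out h1 in \<open>auto simp: D1_def\<close>)
  have \<phi>: "test_function (\<phi> l)" for l
    by (rule test_functionI[of _ R]) (use sm out f1 in \<open>auto simp: \<phi>_def\<close>)
  have supp: "D1 x = 0" if "x \<notin> ball 0 R" for x
    using out[of x] h1 that by (simp add: D1_def)
  have div: "(\<Sum>k\<in>UNIV. grad (\<lambda>y. (d0 + D1 y) * grad (\<phi> l) y $ k) x $ k) = - grad D1 x $ l" for l x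
  proof -
    have "(D1 has_derivative (\<lambda>v. h' (x \<bullet> x) * (2 * (x \<bullet> v)) - 0)) (at x)"
      unfolding D1_def by (intro has_derivative_diff has_derivative_radial dh has_derivative_const)
    from grad_eqI[OF this] have "grad D1 x $ l = 2 * h' (x \<bullet> x) * x $ l" by (simp add: inner_axis)
    then show ?thesis
      using div_radial_flux[OF df df' dh, of l x] ode[of "x \<bullet> x"]
      by (simp add: D1_def \<phi>_def[abs_def])
  qed
  have "admissible d0 (ball 0 R) D1"
    unfolding admissible_def
  proof (intro conjI allI impI exI)
    show "D1 \<in> borel_measurable lebesgue"
      using integrable_test_function[OF D1] by blast
    show "bounded (range D1)"
      using test_function_bounded[OF D1] by (auto simp: bounded_iff)
    show "D1 x = 0" if "x \<notin> closure (ball 0 R)" for x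
      using supp that closure_subset by blast
    show "b > 0" by (rule b)
    show "AE x in lebesgue. d0 + D1 x \<ge> b" using lower by (simp add: D1_def)
  qed
  moreover have "spherically_symmetric D1"
    unfolding spherically_symmetric_def D1_def by (simp flip: power2_norm_eq_inner)
  moreover have "\<not> (AE x in lebesgue. D1 x = 0)"
  proof
    assume "AE x in lebesgue. D1 x = 0"
    then have "AE x in lebesgue. x \<in> D1 -` {0}" by simp
    moreover have "closed (D1 -` {0})"
      using smooth_on_UNIV_continuous[OF sm(1)] by (intro continuous_closed_vimage closed_singleton)
        (simp add: continuous_on_eq_continuous_at)
    ultimately have "0 \<in> D1 -` {0}" using mem_closed_if_AE_lebesgue by blast
    then show False using h0 by (simp add: D1_def)
  qed
  moreover have "polarization_tensor d0 (ball 0 R) D1 i j = 0" if i: "mi_order i = 1" and j: "mi_order j = 1" for i j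
  proof -
    obtain l where l: "monomial i = (\<lambda>x. x $ l)" using monomial_order_1[OF i] by blast
    obtain m where m: "monomial j = (\<lambda>x. x $ m)" using monomial_order_1[OF j] by blast
    show ?thesis
      using polarization_tensor_neutral[OF D1 supp \<phi> div l m is_corrector_neutral[OF D1 \<phi> div m]] .
  qed
  ultimately show ?thesis by blast
qed


end
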